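(* Let $\mathcal{S}$ be a first-countable, compact and convergent semigroup with identity. If a finite subset $\mathcal{M}\subset\mathcal{S}$ has a convergence core $\mathcal{A}\subseteq\mathcal{S}$ of finite height, then $\operatorname{cl}\langle\mathcal{M}\rangle\subseteq\langle\mathcal{M}\cup\mathcal{A}\rangle$.
   Context: A topological semigroup is a semigroup with a Hausdorff topology for which the multiplication is (jointly) continuous. The (right) infinite product $\prod_{i\in\mathbb{N}}S_i$ in a topological semigroup $\mathcal{S}$ is the limit of the sequence $(S_0S_1\cdots S_i)_{i\in\mathbb{N}}$; it converges if this limit exists in $\mathcal{S}$. A topological semigroup is convergent if every infinite product of its elements converges. $\langle X\rangle$ is the subsemigroup generated by $X$; when $\mathcal{S}$ has an identity, $\langle X\rangle$ is by convention also assumed to contain it. $\operatorname{cl}$ denotes topological closure in $\mathcal{S}$. Convergence core: for a convergent semigroup $\mathcal{S}$ and $\mathcal{M}\subseteq\mathcal{S}$, a subset $\mathcal{A}\subseteq\mathcal{S}$ is a convergence core of $\mathcal{M}$ if for every infinite product $\prod_{i\in\mathbb{N}}S_i$ with all $S_i\in\mathcal{M}\cup\mathcal{A}$ there exists $k\in\mathbb{N}$ such that $\prod_{i>k}S_i\in\mathcal{A}$. Height: in a convergent semigroup $\mathcal{S}$ write $A\lhd B$ if there exist $S,T\in\mathcal{S}$ such that $B=SAT$ and $A\neq AT$; this relation is a strict partial order on $\mathcal{S}$. The height of a subset of $\mathcal{S}$ is the maximum cardinality of a chain in that subset with respect to the order induced by $\lhd$ (finite height: the cardinalities of chains are bounded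 by some natural number). *)

theory Defs
  imports "HOL-Analysis.Elementary_Topology"
begin

primrec partial_prod :: "(nat \<Rightarrow> 'a::semigroup_mult) \<Rightarrow> nat \<Rightarrow> 'a" where
  "partial_prod S 0 = S 0"
| "partial_prod S (Suc n) = partial_prod S n * S (Suc n)"

class convergent_semigroup = topological_semigroup_mult + t2_space +
  assumes convergent_partial_prod:
    "convergent (partial_prod (S :: nat \<Rightarrow> 'a::{topological_semigroup_mult, t2_space}))"

definition inf_prod :: "(nat \<Rightarrow> 'a::convergent_semigroup) \<Rightarrow> 'a" where
  "inf_prod S = lim (partial_prod S)"

definition convergence_core :: "'a::convergent_semigroup set \<Rightarrow> 'a set \<Rightarrow> bool" where
  "convergence_core M A \<longleftrightarrow>
     (\<forall>S :: nat \<Rightarrow> 'a. (\<forall>i. S i \<in> M \<union> A) \<longrightarrow> (\<exists>k. inf_prod (\<lambda>i. S (Suc k + i)) \<in> A))"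

definition lhd :: "'a::convergent_semigroup \<Rightarrow> 'a \<Rightarrow> bool" (infix "\<lhd>" 50) where
  "A \<lhd> B \<longleftrightarrow> (\<exists>S T. B = S * A * T \<and> A \<noteq> A * T)"

definition finite_height :: "'a::convergent_semigroup set \<Rightarrow> bool" where
  "finite_height X \<longleftrightarrow> (\<exists>n::nat. \<forall>C. pred_on.chain X (\<lhd>) C \<longrightarrow> finite C \<and> card C \<le> n)"

text \<open>In the presence of an identity, the generated subsemigroup is understood to contain it.\<close>

inductive_set generated :: "'a::monoid_mult set \<Rightarrow> 'a set" for X where
  one: "1 \<in> generated X"
| incl: "x \<in> X \<Longrightarrow> x \<in> generated X"
| mult: "x \<in> generated X \<Longrightarrow> y \<in> generated X \<Longrightarrow> x * y \<in> generated X"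

lemma inf_prod_LIMSEQ: "partial_prod S \<longlonglongrightarrow> inf_prod S"
  unfolding inf_prod_def using convergent_partial_prod convergent_LIMSEQ_iff by blast

lemma lhd_irrefl: "\<not> A \<lhd> A" for A :: "'a::convergent_semigroup"
proof
  assume "A \<lhd> A"
  then obtain S T where ST: "A = S * A * T" "A \<noteq> A * T"
    unfolding lhd_def by blast
  let ?s = "partial_prod (\<lambda>_. S)" and ?t = "partial_prod (\<lambda>_. T)"
  have comm: "T * ?t n = ?t n * T" for n
    by (induction n) (simp_all add: mult.assoc[symmetric])
  have inv: "?s n * A * ?t n = A" for n
  proof (induction n)
    case 0
    then show ?case using ST by simp
  next
    case (Suc n)
    have "?s (Suc n) * A * ?t (Suc n) = ?s n * (S * A * T) * ?t n"
      by (simp add: comm[symmetric] mult.assoc)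
    then show ?case using Suc ST(1) by simp
  qed
  have s: "?s \<longlonglongrightarrow> inf_prod (\<lambda>_. S)" and t: "?t \<longlonglongrightarrow> inf_prod (\<lambda>_. T)"
    by (rule inf_prod_LIMSEQ)+
  have "(\<lambda>n. ?s n * A * ?t n) \<longlonglongrightarrow> inf_prod (\<lambda>_. S) * A * inf_prod (\<lambda>_. T)"
    by (intro tendsto_mult s t tendsto_const)
  then have A: "A = inf_prod (\<lambda>_. S) * A * inf_prod (\<lambda>_. T)"
    unfolding inv using LIMSEQ_unique tendsto_const by blast
  have "(\<lambda>n. ?t (Suc n)) \<longlonglongrightarrow> inf_prod (\<lambda>_. T) * T"
    unfolding partial_prod.simps by (intro tendsto_mult t tendsto_const)
  then have "inf_prod (\<lambda>_. T) * T = inf_prod (\<lambda>_. T)"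
    using LIMSEQ_unique LIMSEQ_Suc[OF t] by blast
  then have "A * T = A"
    by (metis A mult.assoc)
  then show False using ST by simp
qed

lemma lhd_trans:
  fixes A B C :: "'a::convergent_semigroup"
  assumes "A \<lhd> B" "B \<lhd> C"
  shows "A \<lhd> C"
proof -
  obtain S T where ST: "B = S * A * T" "A \<noteq> A * T"
    using assms(1) unfolding lhd_def by blast
  obtain U V where UV: "C = U * B * V"
    using assms(2) unfolding lhd_def by blast
  have "A \<noteq> A * (T * V)"
  proof
    assume eq: "A = A * (T * V)"
    let ?P = "partial_prod (\<lambda>i. if even i then T else V)"
    have odd: "A * ?P (Suc (2 * n)) = A" for n
    proof (induction n)
      case 0
      then show ?case using eq by simp
    next
      case (Suc n)
      have "A * ?P (Suc (2 * Suc n)) = A * ?P (Suc (2 * n)) * (T * V)"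
        by (simp add: mult.assoc)
      then show ?case using Suc eq by simp
    qed
    have even: "A * ?P (2 * Suc n) = A * T" for n
    proof -
      have "A * ?P (2 * Suc n) = A * ?P (Suc (2 * n)) * T"
        by (simp add: mult.assoc)
      then show ?thesis by (simp only: odd)
    qed
    let ?L = "A * inf_prod (\<lambda>i. if even i then T else V)"
    have lim: "(\<lambda>n. A * ?P n) \<longlonglongrightarrow> ?L"
      by (intro tendsto_mult tendsto_const inf_prod_LIMSEQ)
    have "(\<lambda>n. A * ?P (Suc (2 * n))) \<longlonglongrightarrow> ?L" "(\<lambda>n. A * ?P (2 * Suc n)) \<longlonglongrightarrow> ?L"
      using LIMSEQ_subseq_LIMSEQ[OF lim, of "\<lambda>n. Suc (2 * n)"]
        LIMSEQ_subseq_LIMSEQ[OF lim, of "\<lambda>n. 2 * Suc n"]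
      by (simp_all add: strict_mono_def o_def del: partial_prod.simps mult_Suc_right)
    then have "A = A * T"
      unfolding odd even by (simp add: tendsto_const_iff)
    then show False using ST by simp
  qed
  moreover have "C = (U * S) * A * (T * V)"
    using UV ST by (simp add: mult.assoc)
  ultimately show ?thesis unfolding lhd_def by blast
qed

end

theory Submission
  imports Defs
begin

text \<open>
  Fix \<open>x\<close> in the closure \<open>C\<close> of \<open>\<langle>M\<rangle>\<close>, and let \<open>U\<close> be the set of all \<open>u \<in> \<langle>M \<union> A\<rangle>\<close> with \<open>x \<in> u C\<close>.

  Some \<open>u \<in> U\<close> is maximal: \<open>u g \<in> U\<close> and \<open>g \<in> \<langle>M \<union> A\<rangle>\<close> imply \<open>u g = u\<close>. Otherwise every element
  of \<open>U\<close> has a proper extension in \<open>U\<close>. An infinite product of such extensions ends in an element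
  \<open>b \<in> A\<close>, is again in \<open>U\<close> by compactness, and every factor \<open>a\<close> that was followed by a proper
  extension satisfies \<open>a \<lhd> b\<close>. Iterating this yields arbitrarily long chains in \<open>A\<close>.

  For a maximal \<open>u\<close>, let \<open>w\<^sub>n\<close> be a shortest word over \<open>M\<close> such that \<open>u w\<^sub>n\<close> lies in the \<open>n\<close>-th basic
  neighbourhood of \<open>x\<close>. If infinitely many of these words begin with the same letter \<open>m\<close>, then
  \<open>u m \<in> U\<close> by compactness, so \<open>u m = u\<close>, and \<open>m\<close> can be dropped from \<open>w\<^sub>n\<close>, which is absurd.
  As \<open>M\<close> is finite, almost all \<open>w\<^sub>n\<close> are empty and \<open>x = u\<close>.
\<close>

section \<open>Generated submonoids and segments of infinite products\<close>

lemma generated_prod_list: "generated X = prod_list ` lists X"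
proof (intro subset_antisym subsetI)
  fix x assume "x \<in> generated X"
  then show "x \<in> prod_list ` lists X"
  proof induction
    case one
    then show ?case by (force intro: image_eqI[of _ _ "[]"])
  next
    case (incl x)
    then show ?case by (force intro: image_eqI[of _ _ "[x]"])
  next
    case (mult x y)
    then obtain xs ys where "x = prod_list xs" "xs \<in> lists X" "y = prod_list ys" "ys \<in> lists X"
      by blast
    then show ?case by (force intro: image_eqI[of _ _ "xs @ ys"])
  qed
next
  fix x assume "x \<in> prod_list ` lists X"
  then obtain xs where "x = prod_list xs" "xs \<in> lists X" by blast
  moreover have "prod_list xs \<in> generated X" if "xs \<in> lists X"
    using that by (induction xs) (auto intro: generated.intros)
  ultimately show "x \<in> generated X" by blast
qed

text \<open>The upper end is excluded, unlike in \<open>partial_prod\<close>: empty segments are 1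
  and adjacent segments multiply without an index shift.\<close>

definition seg :: "(nat \<Rightarrow> 'a::monoid_mult) \<Rightarrow> nat \<Rightarrow> nat \<Rightarrow> 'a" where
  "seg s m n = prod_list (map s [m..<n])"

lemma seg_self [simp]: "seg s m m = 1"
  by (simp add: seg_def)

lemma seg_mult: "m \<le> n \<Longrightarrow> n \<le> p \<Longrightarrow> seg s m n * seg s n p = seg s m p"
  unfolding seg_def by (metis map_append prod_list.append upt_add_eq_append le_add_diff_inverse)

lemma seg_in_generated: "(\<And>i. s i \<in> X) \<Longrightarrow> seg s m n \<in> generated X"
  unfolding seg_def generated_prod_list by (auto intro!: imageI)

lemma partial_prod_eq_seg: "partial_prod (\<lambda>i. s (m + i)) n = seg s m (m + Suc n)"
  by (induction n) (simp_all add: seg_def mult.assoc)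

lemma seg_LIMSEQ:
  fixes s :: "nat \<Rightarrow> 'a::{convergent_semigroup, monoid_mult}"
  shows "seg s m \<longlonglongrightarrow> inf_prod (\<lambda>i. s (m + i))"
proof -
  have "(\<lambda>n. seg s m (n + Suc m)) \<longlonglongrightarrow> inf_prod (\<lambda>i. s (m + i))"
    using inf_prod_LIMSEQ[of "\<lambda>i. s (m + i)"] unfolding partial_prod_eq_seg
    by (simp add: add.commute)
  then show ?thesis by (rule LIMSEQ_offset)
qed

lemma inf_prod_split:
  fixes s :: "nat \<Rightarrow> 'a::{convergent_semigroup, monoid_mult}"
  assumes "m \<le> n"
  shows "inf_prod (\<lambda>i. s (m + i)) = seg s m n * inf_prod (\<lambda>i. s (n + i))"
proof -
  have "(\<lambda>p. seg s m n * seg s n p) \<longlonglongrightarrow> seg s m n * inf_prod (\<lambda>i. s (n + i))"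
    by (intro tendsto_mult tendsto_const seg_LIMSEQ)
  moreover have "\<forall>\<^sub>F p in sequentially. seg s m n * seg s n p = seg s m p"
    using eventually_ge_at_top[of n] by eventually_elim (simp add: seg_mult assms)
  ultimately have "seg s m \<longlonglongrightarrow> seg s m n * inf_prod (\<lambda>i. s (n + i))"
    by (rule Lim_transform_eventually)
  then show ?thesis using seg_LIMSEQ LIMSEQ_unique by blast
qed

text \<open>Convergence cores speak of sequences of letters, whereas the extensions below are
  products of words. Concatenating words for the factors gives letters; since
  \<open>g i \<noteq> 1\<close>, no word is empty and the letters never run out.\<close>

lemma generated_sequence_blocks:
  assumes "\<And>i. g i \<in> generated X" and "\<And>i. g i \<noteq> 1"
  obtains s f where "\<And>k. s k \<in> X" "strict_mono f" "f 0 = (0::nat)"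
    "\<And>i. seg s (f i) (f (Suc i)) = g i"
proof -
  have "\<exists>w. \<forall>i. w i \<in> lists X \<and> g i = prod_list (w i)"
    using assms(1) unfolding generated_prod_list by (intro choice) blast
  then obtain w where w: "\<And>i. w i \<in> lists X" "\<And>i. g i = prod_list (w i)" by blast
  have ne: "w i \<noteq> []" for i using assms(2)[of i] w(2)[of i] by auto
  define L where "L i = concat (map w [0..<i])" for i
  define f where "f i = length (L i)" for i
  \<comment> \<open>\<open>L (Suc k)\<close> has more than \<open>k\<close> letters since no word is
    empty; any other prefix that is long enough gives the same letter.\<close>
  define s where "s k = L (Suc k) ! k" for k
  have L_Suc: "L (Suc i) = L i @ w i" for i by (simp add: L_def)
  have f_Suc: "f (Suc i) = f i + length (w i)" for i by (simp add: f_def L_Suc)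
  have mono: "strict_mono f" by (simp add: strict_mono_Suc_iff f_Suc ne)
  have f_ge: "i \<le> f i" for i using mono by (rule strict_mono_imp_increasing)
  have L_nth_add: "L i ! k = L (i + d) ! k" if "k < f i" for i k d
  proof (induction d)
    case (Suc d)
    have "f i \<le> f (i + d)" using mono by (simp add: strict_mono_less_eq)
    then have "k < f (i + d)" using that by simp
    then show ?case using Suc by (simp add: L_Suc f_def nth_append)
  qed simp
  have L_nth: "L i ! k = L j ! k" if "k < f i" "i \<le> j" for i j k
    using L_nth_add[of k i "j - i"] that by simp
  have s_nth: "s k = L i ! k" if "k < f i" for i k
  proof (cases "i \<le> Suc k")
    case True
    then show ?thesis unfolding s_def using L_nth[OF that] by simp
  next
    case False
    moreover have "k < f (Suc k)" using f_ge[of "Suc k"] by simp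
    ultimately show ?thesis unfolding s_def using L_nth by simp
  qed
  have "set (L i) \<subseteq> X" for i using w(1) by (auto simp: L_def)
  then have "s k \<in> X" for k
    using f_ge[of "Suc k"] nth_mem[of k "L (Suc k)"] unfolding s_def f_def by fastforce
  moreover have "map s [f i..<f (Suc i)] = w i" for i
    by (rule nth_equalityI) (auto simp: f_Suc s_nth[of _ "Suc i"] L_Suc nth_append f_def)
  moreover have "f 0 = 0" by (simp add: f_def L_def)
  ultimately show ?thesis using that[of s f] mono w(2) by (simp add: seg_def)
qed

section \<open>Extending products and chains\<close>

text \<open>Otherwise \<open>a \<lhd> a * s\<close> and \<open>a * s \<lhd> a\<close>, against the
  strictness of the order.\<close>

lemma mult_right_absorb:
  fixes a s t :: "'a::{convergent_semigroup, monoid_mult}"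
  assumes "a * s * t = a"
  shows "a * s = a"
proof (rule ccontr)
  assume ne: "a * s \<noteq> a"
  have "a \<lhd> a * s" using ne unfolding lhd_def by (metis mult_1_left)
  moreover have "a * s \<lhd> a" using ne assms unfolding lhd_def by (metis mult_1_left)
  ultimately show False using lhd_trans lhd_irrefl by blast
qed

text \<open>The infinite product of the extensions has a tail \<open>b\<close> in the core, and this
  tail still contains an entire factor \<open>g i\<close>. The core dictates which one, so all
  factors have to be prepared alike.\<close>

lemma infinite_extension_in_core:
  fixes x :: "'a::{convergent_semigroup, topological_monoid_mult, first_countable_topology}"
  assumes "compact (UNIV :: 'a set)" and "closed C" and core: "convergence_core M A"
    and g: "\<And>i. g i \<in> generated (M \<union> A)" "\<And>i. g i \<noteq> 1"
    and u: "\<And>i. u (Suc i) = u i * g i"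
    and c: "\<And>i. c i \<in> C" "\<And>i. x = u i * c i"
  shows "\<exists>y \<in> generated (M \<union> A). \<exists>b \<in> A. \<exists>c' \<in> C. x = u 0 * y * b * c' \<and>
           (\<exists>i S T. b = S * g i * T)"
proof -
  obtain s f where s: "\<And>k. s k \<in> M \<union> A" and f: "strict_mono f" "f 0 = (0::nat)"
    and block: "\<And>i. seg s (f i) (f (Suc i)) = g i"
    using generated_sequence_blocks[of g, OF g] by blast
  define P where "P m = inf_prod (\<lambda>i. s (m + i))" for m
  have split: "P m = seg s m n * P n" if "m \<le> n" for m n
    using inf_prod_split[OF that] unfolding P_def .
  have f_mono: "f i \<le> f j" if "i \<le> j" for i j
    using that f(1) by (simp add: strict_mono_less_eq)
  obtain k where k: "P (Suc k) \<in> A"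
    using core s unfolding convergence_core_def P_def by blast
  have ui: "u i = u 0 * seg s 0 (f i)" for i
  proof (induction i)
    case (Suc i)
    have "seg s 0 (f i) * g i = seg s 0 (f (Suc i))"
      using seg_mult[of 0 "f i" "f (Suc i)" s] f_mono[of i "Suc i"] by (simp add: block)
    then show ?case using Suc u by (simp add: mult.assoc)
  qed (simp add: f)
  \<comment> \<open>Along a convergent subsequence of the cofactors \<open>c i\<close>, the equation
    \<open>x = u i * c i\<close> passes to the limit.\<close>
  have "seq_compact (UNIV :: 'a set)"
    using assms(1) by (rule compact_imp_seq_compact)
  then obtain c' r where r: "strict_mono r" "(c \<circ> r) \<longlonglongrightarrow> c'"
    unfolding seq_compact_def by blast
  have "c' \<in> C"
    using closed_sequentially[OF assms(2) _ r(2)] c(1) by simp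
  have "(\<lambda>i. seg s 0 ((f \<circ> r) i)) \<longlonglongrightarrow> P 0"
    using LIMSEQ_subseq_LIMSEQ[OF seg_LIMSEQ[of s 0] strict_mono_o[OF f(1) r(1)]]
    by (simp add: P_def o_def)
  then have "(\<lambda>i. u 0 * seg s 0 ((f \<circ> r) i) * (c \<circ> r) i) \<longlonglongrightarrow> u 0 * P 0 * c'"
    by (intro tendsto_mult tendsto_const r(2))
  moreover have "u 0 * seg s 0 ((f \<circ> r) i) * (c \<circ> r) i = x" for i
    by (simp add: c(2)[of "r i"] ui[of "r i"])
  ultimately have "(\<lambda>i. x) \<longlonglongrightarrow> u 0 * P 0 * c'" by simp
  then have "x = u 0 * P 0 * c'" by (simp add: tendsto_const_iff)
  then have "x = u 0 * seg s 0 (Suc k) * P (Suc k) * c'"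
    using split[of 0 "Suc k"] by (simp add: mult.assoc)
  moreover have "\<exists>i S T. P (Suc k) = S * g i * T"
  proof -
    \<comment> \<open>The block of \<open>g (Suc k)\<close> starts no earlier than position
      \<open>Suc k\<close>, so it lies wholly inside the tail.\<close>
    have "Suc k \<le> f (Suc k)" using f(1) by (rule strict_mono_imp_increasing)
    then have "P (Suc k) = seg s (Suc k) (f (Suc k)) * g (Suc k) * P (f (Suc (Suc k)))"
      using split[of "Suc k" "f (Suc k)"] split[OF f_mono[of "Suc k" "Suc (Suc k)"]]
      by (simp add: mult.assoc block)
    then show ?thesis by blast
  qed
  ultimately show ?thesis
    using k \<open>c' \<in> C\<close> seg_in_generated[of s, OF s] by blast
qed

lemma exists_maximal_left_factor:
  fixes x :: "'a::{convergent_semigroup, topological_monoid_mult, first_countable_topology}"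
  assumes "compact (UNIV :: 'a set)" and "closed C"
    and core: "convergence_core M A" and "finite_height A" and "x \<in> C"
  obtains u c where "u \<in> generated (M \<union> A)" "c \<in> C" "x = u * c"
    "\<And>g c'. g \<in> generated (M \<union> A) \<Longrightarrow> c' \<in> C \<Longrightarrow> x = u * g * c' \<Longrightarrow> u * g = u"
proof (rule ccontr)
  assume no: "\<not> thesis"
  note thesis_rule = that
  define G where "G = generated (M \<union> A)"
  define U where "U = {u \<in> G. \<exists>c\<in>C. x = u * c}"
  have G_mult: "a * b \<in> G" if "a \<in> G" "b \<in> G" for a b
    using that unfolding G_def by (rule generated.mult)
  have one_G: "1 \<in> G" unfolding G_def by (rule generated.one)
  have A_G: "A \<subseteq> G" unfolding G_def by (auto intro: generated.incl)
  have ext: "\<exists>h\<in>G. v * h \<in> U \<and> v * h \<noteq> v" if "v \<in> U" for v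
  proof (rule ccontr)
    assume "\<not> (\<exists>h\<in>G. v * h \<in> U \<and> v * h \<noteq> v)"
    then have max: "v * g = v" if "g \<in> G" "c' \<in> C" "x = v * g * c'" for g c'
      using that \<open>v \<in> U\<close> G_mult unfolding U_def by blast
    obtain c where "v \<in> G" "c \<in> C" "x = v * c" using \<open>v \<in> U\<close> unfolding U_def by blast
    then show False using no thesis_rule[of v c] max unfolding G_def by blast
  qed
  \<comment> \<open>\<open>b\<close> need not belong to \<open>D\<close> or to \<open>A\<close>, so
    the induction can start from the empty chain with \<open>b = 1\<close>.\<close>
  define Q where "Q n b \<longleftrightarrow> (\<exists>D. pred_on.chain A (\<lhd>) D \<and> finite D \<and> card D = n \<and>
      (\<forall>d\<in>D. d = b \<or> d \<lhd> b))" for n b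
  have Q_Suc: "Q (Suc n) b'" if "Q n b" "b \<lhd> b'" "b' \<in> A" for n b b'
  proof -
    from that(1) obtain D where D: "pred_on.chain A (\<lhd>) D" "finite D" "card D = n"
      "\<forall>d\<in>D. d = b \<or> d \<lhd> b" unfolding Q_def by blast
    have below: "\<forall>d\<in>D. d \<lhd> b'" using D(4) that(2) by (metis lhd_trans)
    then have "b' \<notin> D" using lhd_irrefl by blast
    moreover have "pred_on.chain A (\<lhd>) (insert b' D)"
      using D(1) below that(3) unfolding pred_on.chain_def by auto
    ultimately show ?thesis
      unfolding Q_def using D below by (intro exI[of _ "insert b' D"]) simp
  qed
  \<comment> \<open>Stated for every \<open>v \<in> U\<close>, because the induction step uses it
    afresh at each \<open>u i\<close>.\<close>
  have long: "\<forall>v\<in>U. \<exists>y\<in>G. \<exists>b\<in>G. v * y * b \<in> U \<and> Q n b" for n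
  proof (induction n)
    case 0
    have "Q 0 1" unfolding Q_def by (intro exI[of _ "{}"]) (simp add: pred_on.chain_def)
    then show ?case using one_G by force
  next
    case (Suc n)
    have "\<exists>y b h. y \<in> G \<and> b \<in> G \<and> h \<in> G \<and> Q n b \<and> v * y * b * h \<in> U \<and> v * y * b * h \<noteq> v * y * b"
      if "v \<in> U" for v
      using Suc that ext by meson
    then obtain y b h where ybh: "\<And>v. v \<in> U \<Longrightarrow> y v \<in> G \<and> b v \<in> G \<and> h v \<in> G \<and> Q n (b v) \<and>
        v * y v * b v * h v \<in> U \<and> v * y v * b v * h v \<noteq> v * y v * b v"
      by metis
    show ?case
    proof
      fix v assume v: "v \<in> U"
      define u where "u = rec_nat v (\<lambda>_ w. w * y w * b w * h w)"
      \<comment> \<open>The proper extension \<open>h (u i)\<close> after \<open>b (u i)\<close> is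
        what puts \<open>b (u i)\<close> strictly below a tail containing this factor.\<close>
      define g where "g i = y (u i) * b (u i) * h (u i)" for i
      have u0: "u 0 = v" and uS: "u (Suc i) = u i * y (u i) * b (u i) * h (u i)" for i
        unfolding u_def by simp_all
      have uU: "u i \<in> U" for i by (induction i) (use v ybh in \<open>simp_all add: u0 uS\<close>)
      have proper: "u i * y (u i) * b (u i) * h (u i) \<noteq> u i * y (u i) * b (u i)" for i
        using ybh[OF uU] by blast
      have gG: "g i \<in> generated (M \<union> A)" for i
        using ybh[OF uU, of i] G_mult unfolding g_def G_def by blast
      \<comment> \<open>If the factor were 1, absorption would give
        \<open>u i * (y (u i) * b (u i)) = u i\<close>, and appending \<open>h (u i)\<close> would
        change nothing.\<close>
      have g1: "g i \<noteq> 1" for i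
      proof
        assume "g i = 1"
        then have "u i * (y (u i) * b (u i)) * h (u i) = u i"
          unfolding g_def by (simp add: mult.assoc)
        with mult_right_absorb[OF this] show False using proper[of i] by (simp add: mult.assoc)
      qed
      have "\<forall>i. \<exists>c. c \<in> C \<and> x = u i * c" using uU unfolding U_def by blast
      then obtain c where c: "\<And>i. c i \<in> C" "\<And>i. x = u i * c i" by metis
      have ug: "u (Suc i) = u i * g i" for i by (simp add: uS g_def mult.assoc)
      from infinite_extension_in_core[of C M A g u c x, OF assms(1,2) core gG g1 ug c]
      obtain z b' c' i S T where z: "z \<in> G" "b' \<in> A" "c' \<in> C" "x = v * z * b' * c'"
        and b': "b' = S * g i * T" unfolding u0 G_def by blast
      \<comment> \<open>Equality would, again by absorption, make \<open>h (u i)\<close> an improper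
        extension.\<close>
      have "b (u i) \<noteq> b (u i) * (h (u i) * T)"
      proof
        assume "b (u i) = b (u i) * (h (u i) * T)"
        then have "b (u i) * h (u i) = b (u i)"
          using mult_right_absorb[of "b (u i)" "h (u i)" T] by (simp add: mult.assoc)
        then show False using proper[of i] by (simp add: mult.assoc)
      qed
      moreover have "b' = (S * y (u i)) * b (u i) * (h (u i) * T)"
        using b' by (simp add: g_def mult.assoc)
      ultimately have "b (u i) \<lhd> b'" unfolding lhd_def by blast
      then have "Q (Suc n) b'" using Q_Suc ybh[OF uU] z(2) by blast
      moreover have "v * z * b' \<in> U"
        using v z A_G G_mult unfolding U_def by blast
      ultimately show "\<exists>y\<in>G. \<exists>b\<in>G. v * y * b \<in> U \<and> Q (Suc n) b"
        using z A_G by blast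
    qed
  qed
  obtain N where N: "\<And>D. pred_on.chain A (\<lhd>) D \<Longrightarrow> card D \<le> N"
    using assms(4) unfolding finite_height_def by blast
  have "1 \<in> U" using one_G assms(5) unfolding U_def by simp
  then obtain b where "Q (Suc N) b" using long by blast
  then show False using N unfolding Q_def by fastforce
qed

section \<open>The closure of a finitely generated submonoid\<close>

theorem theorem4p3:
  fixes M A :: "'a::{convergent_semigroup, topological_monoid_mult, first_countable_topology} set"
  assumes "compact (UNIV :: 'a set)"
    and "finite M"
    and "convergence_core M A"
    and "finite_height A"
  shows "closure (generated M) \<subseteq> generated (M \<union> A)"
proof
  fix x assume x: "x \<in> closure (generated M)"
  obtain u c where u: "u \<in> generated (M \<union> A)" and c: "c \<in> closure (generated M)" "x = u * c"
    and max: "\<And>g c'. g \<in> generated (M \<union> A) \<Longrightarrow> c' \<in> closure (generated M) \<Longrightarrow>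
      x = u * g * c' \<Longrightarrow> u * g = u"
    using exists_maximal_left_factor[OF assms(1) closed_closure assms(3,4) x] by metis
  obtain V where V: "\<And>i::nat. open (V i)" "\<And>i. x \<in> V i"
    and V_lim: "\<And>F. (\<And>n. F n \<in> V n) \<Longrightarrow> F \<longlonglongrightarrow> x"
    using first_countable_topology_class.countable_basis by metis
  obtain d where d: "\<And>n. d n \<in> generated M" "d \<longlonglongrightarrow> c"
    using c(1) unfolding closure_sequential by blast
  have d_lim: "(\<lambda>n. u * d n) \<longlonglongrightarrow> x"
    unfolding c(2) by (intro tendsto_mult tendsto_const d)
  \<comment> \<open>Guarantees that the \<open>arg_min\<close> below is taken over a nonempty set;
    otherwise its value would be arbitrary.\<close>
  have near: "\<exists>w. w \<in> lists M \<and> u * prod_list w \<in> V n" for n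
  proof -
    have "\<forall>\<^sub>F i in sequentially. u * d i \<in> V n"
      using d_lim V by (rule topological_tendstoD)
    then obtain i where "u * d i \<in> V n" using eventually_happens'[OF sequentially_bot] by blast
    then show ?thesis using d(1)[of i] unfolding generated_prod_list by auto
  qed
  define w where "w n = arg_min length (\<lambda>w. w \<in> lists M \<and> u * prod_list w \<in> V n)" for n
  have w: "w n \<in> lists M" "u * prod_list (w n) \<in> V n" for n
    using arg_min_natI[of "\<lambda>w. w \<in> lists M \<and> u * prod_list w \<in> V n"] near[of n]
    unfolding w_def by blast+
  have w_min: "length (w n) \<le> length v" if "v \<in> lists M" "u * prod_list v \<in> V n" for n v
    using arg_min_nat_le[of "\<lambda>w. w \<in> lists M \<and> u * prod_list w \<in> V n" v length] that
    unfolding w_def by blast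
  have w_lim: "(\<lambda>n. u * prod_list (w n)) \<longlonglongrightarrow> x" by (rule V_lim) (rule w)
  have fin: "finite {n. w n \<noteq> [] \<and> hd (w n) = m}" if "m \<in> M" for m
  proof (rule ccontr)
    assume inf: "infinite {n. w n \<noteq> [] \<and> hd (w n) = m}"
    then obtain p :: "nat \<Rightarrow> nat" where p: "strict_mono p"
      and "\<And>n. p n \<in> {n. w n \<noteq> [] \<and> hd (w n) = m}"
      using infinite_enumerate by blast
    then have wp: "w (p n) = m # tl (w (p n))" for n by (metis (mono_tags) list.collapse mem_Collect_eq)
    define t where "t n = prod_list (tl (w (p n)))" for n
    have tl_M: "tl (w (p n)) \<in> lists M" for n using w(1)[of "p n"] wp[of n] by (metis Cons_in_lists_iff)
    obtain c' r where r: "strict_mono r" "(t \<circ> r) \<longlonglongrightarrow> c'"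
      using compact_imp_seq_compact[OF assms(1)] unfolding seq_compact_def by blast
    have "t n \<in> generated M" for n
      using tl_M unfolding t_def generated_prod_list by blast
    then have c': "c' \<in> closure (generated M)"
      using r(2) unfolding closure_sequential by (intro exI[of _ "t \<circ> r"]) simp
    have wt: "u * prod_list (w (p n)) = u * m * t n" for n
      by (subst wp) (simp add: t_def mult.assoc)
    \<comment> \<open>One subsequence with the two limits \<open>u * m * c'\<close> and
      \<open>x\<close>: thus \<open>u * m\<close> is a left factor of \<open>x\<close>, and the
      maximality of \<open>u\<close> applies.\<close>
    have "(\<lambda>n. u * m * (t \<circ> r) n) \<longlonglongrightarrow> u * m * c'"
      by (intro tendsto_mult tendsto_const r)
    moreover have "(\<lambda>n. u * m * (t \<circ> r) n) \<longlonglongrightarrow> x"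
      using LIMSEQ_subseq_LIMSEQ[OF w_lim strict_mono_o[OF p r(1)]] by (simp add: o_def wt)
    ultimately have "x = u * m * c'" by (rule LIMSEQ_unique[symmetric])
    then have "u * m = u" using max[of m c'] c' that by (simp add: generated.incl)
    \<comment> \<open>As \<open>u\<close> absorbs the first letter, the shorter word reaches the
      same neighbourhood and undercuts the minimal length.\<close>
    then have "u * prod_list (tl (w (p 0))) \<in> V (p 0)"
      using w(2)[of "p 0"] wt[of 0] by (simp add: t_def)
    then have "length (w (p 0)) \<le> length (tl (w (p 0)))" using w_min tl_M by blast
    then show False using wp[of 0] by (metis length_Cons not_less_eq_eq order_refl)
  qed
  \<comment> \<open>Every nonempty word begins with one of finitely many letters, and each letter
    begins only finitely many \<open>w n\<close>.\<close>
  have "{n. w n \<noteq> []} \<subseteq> (\<Union>m\<in>M. {n. w n \<noteq> [] \<and> hd (w n) = m})"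
    using w(1) hd_in_set by fastforce
  then have "finite {n. w n \<noteq> []}" using fin assms(2) finite_subset by blast
  then have "\<forall>\<^sub>F n in sequentially. w n = []"
    by (simp add: eventually_cofinite cofinite_eq_sequentially[symmetric])
  then have "\<forall>\<^sub>F n in sequentially. u * prod_list (w n) = u" by eventually_elim simp
  then have "(\<lambda>n. u) \<longlonglongrightarrow> x" by (rule Lim_transform_eventually[OF w_lim])
  then have "x = u" by (simp add: tendsto_const_iff)
  then show "x \<in> generated (M \<union> A)" using u by simp
qed

end
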